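(* For every fixed $c\in[1,\infty)$, \[ \Pr\bigl[L_n\ge c\ln n\bigr]=n^{-K(c)+o(1)}\qquad(n\to\infty), \] where $K(c)=\dfrac{(1-c)^2}{8c}$.
   Context: Let $\xi_1,\xi_2,\dots$ be i.i.d. random variables with $\Pr[\xi_i=1]=\Pr[\xi_i=-1]=1/2$, and let $S_t=\sum_{i=1}^t\xi_i$ (simple symmetric random walk, $S_0=0$). Define $L_n=\sum_{i=1}^n S_i^2/i^2$. *)

theory Defs
  imports "HOL-Probability.Probability"
begin

text \<open>Sign sequences of length n: xi i in {-1,1} for i in {1..n} (undefined elsewhere).
  The uniform distribution on them is the law of (xi_1,...,xi_n) for i.i.d. fair signs.\<close>
definition sign_seqs :: "nat \<Rightarrow> (nat \<Rightarrow> int) set" where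
  "sign_seqs n = Pi\<^sub>E {1..n} (\<lambda>_. {-1, 1})"

definition walk :: "(nat \<Rightarrow> int) \<Rightarrow> nat \<Rightarrow> int" where
  "walk xi t = (\<Sum>i=1..t. xi i)"

definition Lsum :: "(nat \<Rightarrow> int) \<Rightarrow> nat \<Rightarrow> real" where
  "Lsum xi n = (\<Sum>i=1..n. (real_of_int (walk xi i))\<^sup>2 / (real i)\<^sup>2)"

definition tailprob :: "real \<Rightarrow> nat \<Rightarrow> real" where
  "tailprob c n = measure_pmf.prob (pmf_of_set (sign_seqs n)) {xi. Lsum xi n \<ge> c * ln (real n)}"

definition Krate :: "real \<Rightarrow> real" where
  "Krate c = (1 - c)\<^sup>2 / (8 * c)"

end

theory Submission
  imports Defs
begin

text \<open>
  Let \<open>a \<in> [0, 1/4)\<close> and \<open>\<lambda> = a - 2 a\<^sup>2\<close>. On the time scale \<open>t = e\<^sup>s\<close> the process \<open>S\<^sub>t / \<surd>t\<close> is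
  close to an Ornstein-Uhlenbeck process with generator \<open>f''/2 - x f'/2\<close>, and \<open>exp (a x\<^sup>2)\<close> is an
  eigenfunction of this generator plus \<open>\<lambda> x\<^sup>2\<close>, with eigenvalue \<open>a\<close>. So \<open>E exp (\<lambda> L\<^sub>n)\<close> should be
  \<open>n\<close> to the power \<open>a + o(1)\<close>.

  The upper bound comes from a discrete supersolution \<open>exp (v\<^sub>i s\<^sup>2)\<close>, using \<open>cosh x \<le> exp (x\<^sup>2 / 2)\<close>.
  The lower bound comes from the subsolution \<open>exp (a s\<^sup>2 / i - b s\<^sup>4 / i\<^sup>2)\<close> with small \<open>b > 0\<close>: the
  quartic term makes it bounded and costs only \<open>O(b)\<close> in the exponent, because \<open>a < 1/4\<close>.

  Markov's inequality with \<open>a = (c - 1) / (4 c)\<close> gives the upper tail bound. For the lower tail bound,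
  tilt by \<open>exp (\<lambda> L\<^sub>n)\<close>: since \<open>da/d\<lambda> = 1 / (1 - 4 a)\<close>, comparing the generating functions at
  neighbouring parameters shows that the tilted law of \<open>L\<^sub>n / ln n\<close> concentrates at \<open>1 / (1 - 4 a)\<close>,
  which is taken slightly above \<open>c\<close>.
\<close>

subsection \<open>One step of the walk\<close>

text \<open>The expectation of \<open>exp (lam * Lsum xi n + f (walk xi n))\<close> as a finite sum.
  The terminal weight \<open>f\<close> makes a recursion in \<open>n\<close> possible: averaging
  over the last sign turns it into a weight at the previous time.\<close>

definition tilt :: "real \<Rightarrow> nat \<Rightarrow> (real \<Rightarrow> real) \<Rightarrow> real" where
  "tilt lam n f =
     (\<Sum>xi\<in>sign_seqs n. exp (lam * Lsum xi n + f (real_of_int (walk xi n)))) / 2 ^ n"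

lemma sum_sign_seqs_Suc:
  fixes F :: "(nat \<Rightarrow> int) \<Rightarrow> real"
  shows "sum F (sign_seqs (Suc n)) =
    (\<Sum>xi\<in>sign_seqs n. F (xi(Suc n := 1)) + F (xi(Suc n := -1)))"
proof -
  have "sign_seqs (Suc n) = Pi\<^sub>E (insert (Suc n) {1..n}) (\<lambda>_. {-1, 1})"
    unfolding sign_seqs_def by (simp add: atLeastAtMostSuc_conv)
  also have "\<dots> = (\<lambda>(y, g). g(Suc n := y)) ` ({-1, 1} \<times> sign_seqs n)"
    unfolding sign_seqs_def PiE_insert_eq by simp
  finally have eq: "sign_seqs (Suc n) = (\<lambda>(y, g). g(Suc n := y)) ` ({-1, 1} \<times> sign_seqs n)" .
  have inj: "inj_on (\<lambda>(y, g). g(Suc n := y)) ({-1, 1::int} \<times> sign_seqs n)"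
    unfolding sign_seqs_def by (rule inj_combinator) simp
  have "sum F (sign_seqs (Suc n)) = (\<Sum>y\<in>{-1,1}. \<Sum>g\<in>sign_seqs n. F (g(Suc n := y)))"
    unfolding eq by (subst sum.reindex[OF inj]) (simp add: sum.cartesian_product case_prod_unfold comp_def)
  then show ?thesis by (simp add: sum.distrib add.commute)
qed

lemma walk_fun_upd_less: "t < k \<Longrightarrow> walk (xi(k := y)) t = walk xi t"
  unfolding walk_def by (intro sum.cong) auto

lemma walk_fun_upd_Suc: "walk (xi(Suc n := y)) (Suc n) = walk xi n + y"
  using walk_fun_upd_less[of n "Suc n" xi y] by (simp add: walk_def)

lemma Lsum_fun_upd_Suc:
  "Lsum (xi(Suc n := y)) (Suc n) =
     Lsum xi n + (real_of_int (walk xi n) + real_of_int y)\<^sup>2 / (real (Suc n))\<^sup>2"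
proof -
  have "Lsum (xi(Suc n := y)) n = Lsum xi n"
    unfolding Lsum_def by (intro sum.cong) (auto simp: walk_fun_upd_less)
  moreover have "Lsum (xi(Suc n := y)) (Suc n) = Lsum (xi(Suc n := y)) n
     + (real_of_int (walk (xi(Suc n := y)) (Suc n)))\<^sup>2 / (real (Suc n))\<^sup>2"
    unfolding Lsum_def by simp
  ultimately show ?thesis by (simp add: walk_fun_upd_Suc)
qed

text \<open>The one-step Feynman-Kac operator: \<open>s\<close> is the position at time
  \<open>i - 1\<close>, and the average is over the sign at time \<open>i\<close>.\<close>

definition step_mean :: "real \<Rightarrow> nat \<Rightarrow> (real \<Rightarrow> real) \<Rightarrow> real \<Rightarrow> real" where
  "step_mean lam i f s =
     (exp (lam * (s + 1)\<^sup>2 / (real i)\<^sup>2 + f (s + 1)) + exp (lam * (s - 1)\<^sup>2 / (real i)\<^sup>2 + f (s - 1))) / 2"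

lemma tilt_Suc:
  "tilt lam (Suc n) f =
     (\<Sum>xi\<in>sign_seqs n. exp (lam * Lsum xi n) * step_mean lam (Suc n) f (real_of_int (walk xi n))) / 2 ^ n"
proof -
  have "exp (lam * Lsum (xi(Suc n := 1)) (Suc n) + f (real_of_int (walk (xi(Suc n := 1)) (Suc n))))
      + exp (lam * Lsum (xi(Suc n := -1)) (Suc n) + f (real_of_int (walk (xi(Suc n := -1)) (Suc n))))
      = 2 * (exp (lam * Lsum xi n) * step_mean lam (Suc n) f (real_of_int (walk xi n)))" for xi
    unfolding Lsum_fun_upd_Suc walk_fun_upd_Suc step_mean_def
    by (simp add: exp_add distrib_left algebra_simps)
  then show ?thesis
    unfolding tilt_def sum_sign_seqs_Suc by (simp add: sum_distrib_left[symmetric])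
qed

text \<open>A pointwise one-step inequality suffices because the accumulated weights
  \<open>exp (lam * Lsum xi n)\<close> are positive. Here \<open>k\<close> is the exponent gained in
  the step; \<open>tilt_Suc_ge\<close> is the mirror image.\<close>

lemma tilt_Suc_le:
  assumes "\<And>s. step_mean lam (Suc n) f s \<le> exp (k + g s)"
  shows "tilt lam (Suc n) f \<le> exp k * tilt lam n g"
proof -
  have "exp (lam * Lsum xi n) * step_mean lam (Suc n) f (real_of_int (walk xi n))
     \<le> exp k * exp (lam * Lsum xi n + g (real_of_int (walk xi n)))" for xi
    using mult_left_mono[OF assms[of "real_of_int (walk xi n)"], of "exp (lam * Lsum xi n)"]
    by (simp add: exp_add mult_ac)
  then show ?thesis
    unfolding tilt_Suc unfolding tilt_def times_divide_eq_right sum_distrib_left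
    by (intro divide_right_mono sum_mono) auto
qed

lemma tilt_Suc_ge:
  assumes "\<And>s. exp (k + g s) \<le> step_mean lam (Suc n) f s"
  shows "exp k * tilt lam n g \<le> tilt lam (Suc n) f"
proof -
  have "exp k * exp (lam * Lsum xi n + g (real_of_int (walk xi n)))
     \<le> exp (lam * Lsum xi n) * step_mean lam (Suc n) f (real_of_int (walk xi n))" for xi
    using mult_left_mono[OF assms[of "real_of_int (walk xi n)"], of "exp (lam * Lsum xi n)"]
    by (simp add: exp_add mult_ac)
  then show ?thesis
    unfolding tilt_Suc unfolding tilt_def times_divide_eq_right sum_distrib_left
    by (intro divide_right_mono sum_mono) auto
qed

lemma finite_sign_seqs [simp]: "finite (sign_seqs n)"
  by (simp add: sign_seqs_def finite_PiE)

lemma sign_seqs_nonempty [simp]: "sign_seqs n \<noteq> {}"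
  by (simp add: sign_seqs_def PiE_eq_empty_iff)

lemma card_sign_seqs: "card (sign_seqs n) = 2 ^ n"
  by (simp add: sign_seqs_def card_PiE numeral_2_eq_2)

lemma tilt_pos: "tilt lam n f > 0"
  unfolding tilt_def by (intro divide_pos_pos sum_pos) auto

lemma tilt_mono: "(\<And>s. f s \<le> g s) \<Longrightarrow> tilt lam n f \<le> tilt lam n g"
  unfolding tilt_def by (intro divide_right_mono sum_mono) auto

lemma tilt_add_const: "tilt lam n (\<lambda>s. k + f s) = exp k * tilt lam n f"
  by (simp add: tilt_def exp_add sum_distrib_left mult_ac)

lemma tilt_1: "tilt lam (Suc 0) f = step_mean lam (Suc 0) f 0"
  by (simp add: tilt_Suc sign_seqs_def Lsum_def walk_def)

subsection \<open>Upper bound for the moment generating function\<close>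

lemma fact_double_ge: "(2::real) ^ n * fact n \<le> fact (2 * n)"
proof (induction n)
  case (Suc n)
  have "(2::real) ^ Suc n * fact (Suc n) = (2 * real (Suc n)) * (2 ^ n * fact n)"
    by simp
  also have "\<dots> \<le> (2 * real (Suc n) * real (2 * n + 1)) * fact (2 * n)"
    using Suc by (intro mult_mono) auto
  also have "\<dots> = fact (2 * Suc n)"
    by (simp add: algebra_simps)
  finally show ?case .
qed simp

lemma cosh_sums_even: "(\<lambda>n. x ^ (2 * n) / fact (2 * n)) sums cosh (x::real)"
proof -
  have "(\<lambda>n. if even (2 * n) then x ^ (2 * n) /\<^sub>R fact (2 * n) else 0) sums cosh x"
    using cosh_converges[of x]
    by (subst sums_mono_reindex[of "\<lambda>n. 2 * n"]) (auto simp: strict_mono_def elim!: evenE)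
  then show ?thesis by (simp add: divide_inverse mult.commute)
qed

text \<open>The power series compare term by term, by \<open>fact_double_ge\<close>.\<close>

lemma cosh_le_exp_square: "cosh (x::real) \<le> exp (x\<^sup>2 / 2)"
proof (rule sums_le)
  show "(\<lambda>n. x ^ (2 * n) / fact (2 * n)) sums cosh x"
    by (rule cosh_sums_even)
  show "(\<lambda>n. (x\<^sup>2 / 2) ^ n /\<^sub>R fact n) sums exp (x\<^sup>2 / 2)"
    by (rule exp_converges)
  fix n
  have "x ^ (2 * n) / fact (2 * n) \<le> (x\<^sup>2) ^ n / (2 ^ n * fact n)"
    unfolding power_mult by (intro divide_left_mono fact_double_ge) auto
  also have "\<dots> = (x\<^sup>2 / 2) ^ n /\<^sub>R fact n"
    by (simp add: power_divide field_simps)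
  finally show "x ^ (2 * n) / fact (2 * n) \<le> (x\<^sup>2 / 2) ^ n /\<^sub>R fact n" .
qed

lemma cosh_ge_quadratic: "1 + x\<^sup>2 / 2 \<le> cosh (x::real)"
proof -
  have "sum (\<lambda>n. x ^ (2 * n) / fact (2 * n)) {..<2} \<le> cosh x"
    unfolding sums_unique[OF cosh_sums_even]
    by (rule sum_le_suminf) (use sums_summable[OF cosh_sums_even] in auto)
  then show ?thesis by (simp add: numeral_2_eq_2)
qed

text \<open>With \<open>u = x\<^sup>2 / 2\<close>, this is
  \<open>u - u\<^sup>2 \<le> ln (1 + u)\<close> for \<open>u\<close> at most 1; beyond that the
  exponent is nonpositive.\<close>

lemma cosh_ge_exp: "exp (x\<^sup>2 / 2 - x ^ 4 / 4) \<le> cosh (x::real)"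
proof (cases "x\<^sup>2 / 2 \<le> 1")
  case True
  have "x\<^sup>2 / 2 - x ^ 4 / 4 \<le> ln (1 + x\<^sup>2 / 2)"
    using ln_one_plus_pos_lower_bound[of "x\<^sup>2 / 2"] True by (simp add: power_divide flip: power_mult)
  then have "exp (x\<^sup>2 / 2 - x ^ 4 / 4) \<le> 1 + x\<^sup>2 / 2"
    by (subst (asm) ln_ge_iff) (auto intro: add_pos_nonneg)
  then show ?thesis using cosh_ge_quadratic[of x] by linarith
next
  case False
  then have "x\<^sup>2 / 2 * 1 \<le> x\<^sup>2 / 2 * (x\<^sup>2 / 2)" by (intro mult_left_mono) auto
  then have "exp (x\<^sup>2 / 2 - x ^ 4 / 4) \<le> 1"
    by (simp flip: power_add power2_eq_square add: power_divide flip: power_mult)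
  then show ?thesis using cosh_real_ge_1[of x] by linarith
qed

text \<open>The even parts of \<open>(s + 1)\<^sup>2\<close> and \<open>(s + 1) ^ 4\<close> are
  common to both signs and factor out; the odd parts form the argument of \<open>cosh\<close>. Both
  the supersolution (\<open>q = 0\<close>) and the subsolution have this shape.\<close>

lemma step_mean_quartic:
  "step_mean lam i (\<lambda>s. v * s\<^sup>2 - q * s ^ 4) s =
    (let p = v + lam / (real i)\<^sup>2 in
      exp (p * (s\<^sup>2 + 1) - q * (s ^ 4 + 6 * s\<^sup>2 + 1)) * cosh (2 * p * s - q * (4 * s ^ 3 + 4 * s)))"
proof -
  define p where "p = v + lam / (real i)\<^sup>2"
  have 1: "lam * (s + 1)\<^sup>2 / (real i)\<^sup>2 + (v * (s+1)\<^sup>2 - q * (s+1) ^ 4)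
    = (p * (s\<^sup>2 + 1) - q * (s ^ 4 + 6 * s\<^sup>2 + 1)) + (2 * p * s - q * (4 * s ^ 3 + 4 * s))"
    unfolding p_def by (simp add: algebra_simps power2_eq_square power3_eq_cube power4_eq_xxxx
        add_divide_distrib diff_divide_distrib)
  have 2: "lam * (s - 1)\<^sup>2 / (real i)\<^sup>2 + (v * (s-1)\<^sup>2 - q * (s-1) ^ 4)
    = (p * (s\<^sup>2 + 1) - q * (s ^ 4 + 6 * s\<^sup>2 + 1)) - (2 * p * s - q * (4 * s ^ 3 + 4 * s))"
    unfolding p_def by (simp add: algebra_simps power2_eq_square power3_eq_cube power4_eq_xxxx
        add_divide_distrib diff_divide_distrib)
  show ?thesis
    unfolding step_mean_def 1 2 unfolding p_def[symmetric] Let_def cosh_def exp_add exp_diff exp_minus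
    by (simp add: field_simps)
qed

section \<open>The quadratic supersolution\<close>

text \<open>The orders 1/m and 1/m^2 agree on both sides because
  \<open>lam = a - 2 * a\<^sup>2\<close>. The summand 1/2 leaves room at the next order: after
  clearing denominators the slack is at least \<open>m - a * (3 * m + 1)\<close>, which is
  nonnegative for \<open>a < 1/4\<close>.\<close>

lemma upper_coeff_step:
  fixes a m :: real
  assumes a: "0 \<le> a" "a < 1/4" and m: "1 \<le> m"
  defines "p \<equiv> a / (m + 1) + 1 / (2 * (m + 1)\<^sup>2)"
  shows "p + 2 * p\<^sup>2 \<le> a / m + (1/2 - (a - 2 * a\<^sup>2)) / m\<^sup>2"
proof -
  define w where "w = m + 1"
  have pos: "m > 0" "w > 0" using m by (auto simp: w_def)
  define X where "X = a * m * w\<^sup>2 + (1/2 - (a - 2 * a\<^sup>2)) * w\<^sup>2"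
  have pw: "p * w = a + 1 / (2 * w)"
    using pos unfolding p_def w_def[symmetric] by (simp add: distrib_right power2_eq_square)
  have pww: "p * w * w = a * w + 1/2"
    using pos unfolding pw by (simp add: distrib_right)
  have "m * (p * w) = a * m + (m / w) / 2"
    unfolding pw by (simp add: distrib_left mult.commute)
  also have "\<dots> \<le> a * m + 1/2"
    using pos by (simp add: w_def)
  finally have "(m * (p * w))\<^sup>2 \<le> (a * m + 1/2)\<^sup>2"
    using pos a by (intro power_mono) (auto simp: p_def w_def)
  moreover have "(p + 2 * p\<^sup>2) * (m\<^sup>2 * w\<^sup>2) = m\<^sup>2 * (p * w * w) + 2 * (m * (p * w))\<^sup>2"
    by (simp add: power2_eq_square algebra_simps)
  ultimately have 1: "(p + 2 * p\<^sup>2) * (m\<^sup>2 * w\<^sup>2) \<le> m\<^sup>2 * (a * w + 1/2) + 2 * (a * m + 1/2)\<^sup>2"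
    unfolding pww by linarith
  note 1
  also have "m\<^sup>2 * (a * w + 1/2) + 2 * (a * m + 1/2)\<^sup>2 =
      X - (m - a * (3 * m + 1) + 2 * a\<^sup>2 * (2 * m + 1))"
    unfolding X_def w_def by (simp add: power2_eq_square algebra_simps)
  also have "\<dots> \<le> X"
  proof -
    have "a * (3 * m + 1) \<le> 1/4 * (3 * m + 1)"
      using a pos by (intro mult_right_mono) auto
    also have "\<dots> \<le> m" using m by simp
    also have "\<dots> \<le> m + 2 * a\<^sup>2 * (2 * m + 1)" using pos by simp
    finally show ?thesis by simp
  qed
  finally have "(p + 2 * p\<^sup>2) * (m\<^sup>2 * w\<^sup>2) \<le> X" .
  then have "p + 2 * p\<^sup>2 \<le> X / (m\<^sup>2 * w\<^sup>2)"
    using pos by (simp add: pos_le_divide_eq)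
  also have "\<dots> = a / m + (1/2 - (a - 2 * a\<^sup>2)) / m\<^sup>2"
    using pos unfolding X_def add_divide_distrib by (simp add: power2_eq_square)
  finally show ?thesis .
qed

text \<open>Bounding \<open>cosh (2 * p * s)\<close> adds \<open>2 * p\<^sup>2 * s\<^sup>2\<close>
  to the exponent, which \<open>upper_coeff_step\<close> absorbs into the coefficient at time
  \<open>m\<close>.\<close>

lemma step_mean_upper:
  fixes a :: real
  assumes a: "0 \<le> a" "a < 1/4" and m: "1 \<le> m"
  defines "v \<equiv> \<lambda>i. a / real i + (1/2 - (a - 2 * a\<^sup>2)) / (real i)\<^sup>2"
  shows "step_mean (a - 2 * a\<^sup>2) (Suc m) (\<lambda>s. v (Suc m) * s\<^sup>2) s
           \<le> exp ((a / (real m + 1) + 1 / (2 * (real m + 1)\<^sup>2)) + v m * s\<^sup>2)"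
proof -
  define p where "p = a / (real m + 1) + 1 / (2 * (real m + 1)\<^sup>2)"
  have p: "v (Suc m) + (a - 2 * a\<^sup>2) / (real (Suc m))\<^sup>2 = p"
    by (simp add: v_def p_def add_divide_distrib diff_divide_distrib add.commute)
  have "step_mean (a - 2 * a\<^sup>2) (Suc m) (\<lambda>s. v (Suc m) * s\<^sup>2) s = exp (p * (s\<^sup>2 + 1)) * cosh (2 * p * s)"
    using step_mean_quartic[of "a - 2 * a\<^sup>2" "Suc m" "v (Suc m)" 0 s] unfolding p by simp
  also have "\<dots> \<le> exp (p * (s\<^sup>2 + 1)) * exp ((2 * p * s)\<^sup>2 / 2)"
    by (intro mult_left_mono cosh_le_exp_square) auto
  also have "\<dots> = exp (p + (p + 2 * p\<^sup>2) * s\<^sup>2)"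
    by (simp add: exp_add[symmetric] algebra_simps power2_eq_square)
  also have "\<dots> \<le> exp (p + v m * s\<^sup>2)"
    using upper_coeff_step[OF a, of "real m"] m unfolding p_def[symmetric] v_def
    by (simp add: mult_right_mono)
  finally show ?thesis unfolding p_def .
qed

lemma mgf_upper:
  fixes a :: real
  assumes a: "0 \<le> a" "a < 1/4" and n: "1 \<le> n"
  shows "tilt (a - 2 * a\<^sup>2) n (\<lambda>_. 0) \<le> exp 2 * real n powr a"
proof -
  define lam where "lam = a - 2 * a\<^sup>2"
  define v where "v i = a / real i + (1/2 - lam) / (real i)\<^sup>2" for i
  have "a * a \<le> a * (1/4)" using a by (intro mult_left_mono) auto
  then have lam: "lam \<le> 1/2" "0 \<le> lam" using a zero_le_square[of a] unfolding lam_def power2_eq_square by linarith+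
  \<comment> \<open>At \<open>n = 1\<close> this is an equality. The harmonic parts of the step
    costs sum to at most \<open>a * (1 + ln n)\<close>, and the quadratic parts are paid for by the
    increase of \<open>- 1 / (2 * n)\<close>.\<close>
  have main: "tilt lam n (\<lambda>s. v n * s\<^sup>2) \<le> exp (a * (1 + ln (real n)) + 1 - 1 / (2 * real n))"
    using n
  proof (induction n rule: nat_induct_at_least)
    case base
    show ?case by (simp add: tilt_1 step_mean_def v_def)
  next
    case (Suc m)
    define k where "k = a / (real m + 1) + 1 / (2 * (real m + 1)\<^sup>2)"
    have m: "real m > 0" using Suc by auto
    have "tilt lam (Suc m) (\<lambda>s. v (Suc m) * s\<^sup>2) \<le> exp k * tilt lam m (\<lambda>s. v m * s\<^sup>2)"
      using step_mean_upper[OF a, of m] Suc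
      by (intro tilt_Suc_le) (simp add: k_def v_def lam_def)
    also have "\<dots> \<le> exp k * exp (a * (1 + ln (real m)) + 1 - 1 / (2 * real m))"
      using Suc by (intro mult_left_mono) auto
    also have "\<dots> = exp (k + (a * (1 + ln (real m)) + 1 - 1 / (2 * real m)))"
      by (simp add: exp_add)
    also have "\<dots> \<le> exp (a * (1 + ln (real (Suc m))) + 1 - 1 / (2 * real (Suc m)))"
    proof -
      have "ln (real m / (real m + 1)) \<le> real m / (real m + 1) - 1"
        using m by (intro ln_le_minus_one) auto
      also have "\<dots> = - 1 / (real m + 1)" by (simp add: field_simps)
      finally have "1 / (real m + 1) \<le> ln (real m + 1) - ln (real m)"
        using m by (simp add: ln_div)
      from mult_left_mono[OF this a(1)]
      have 1: "a / (real m + 1) \<le> a * ln (real m + 1) - a * ln (real m)"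
        by (simp add: algebra_simps)
      have 2: "1 / (2 * (real m + 1)\<^sup>2) \<le> 1 / (2 * real m) - 1 / (2 * (real m + 1))"
      proof -
        have "1 / (2 * (real m + 1)\<^sup>2) \<le> 1 / (2 * (real m * (real m + 1)))"
          using m by (intro divide_left_mono) (auto simp: power2_eq_square)
        also have "\<dots> = 1 / (2 * real m) - 1 / (2 * (real m + 1))"
          using m by (simp add: divide_simps)
        finally show ?thesis .
      qed
      show ?thesis using 1 2 by (simp add: k_def algebra_simps)
    qed
    finally show ?case .
  qed
  have "tilt lam n (\<lambda>_. 0) \<le> tilt lam n (\<lambda>s. v n * s\<^sup>2)"
    using a lam by (intro tilt_mono) (simp add: v_def)
  also note main
  also have "exp (a * (1 + ln (real n)) + 1 - 1 / (2 * real n)) \<le> exp (2 + a * ln (real n))"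
    using a n by (simp add: algebra_simps add_increasing2)
  also have "\<dots> = exp 2 * real n powr a"
    using n by (simp add: exp_add powr_def)
  finally show ?thesis unfolding lam_def .
qed

subsection \<open>Lower bound for the moment generating function\<close>

text \<open>
  Here \<open>y = s\<^sup>2 / i\<close>, and \<open>l\<close> stands for a lower bound of the logarithm of the hyperbolic cosine
  occurring in \<open>step_mean_quartic\<close>.
\<close>

lemma step_exponent_lower:
  fixes a b d s y l m i lam :: real
  assumes a: "0 \<le> a" "a < 1/4" and b: "0 < b" and m: "1 \<le> m"
  defines "i \<equiv> m + 1" and "lam \<equiv> a - 2 * a\<^sup>2"
  assumes y: "s\<^sup>2 = i * y"
    and l: "0 \<le> d - b / i - y * (2 * a\<^sup>2 + 6 * b + a / m) + 2 * b * y\<^sup>2 + i * l"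
  shows "(a - d) / i + (a / m * s\<^sup>2 - b / m\<^sup>2 * s ^ 4)
     \<le> (a / i + lam / i\<^sup>2) * (s\<^sup>2 + 1) - b / i\<^sup>2 * (s ^ 4 + 6 * s\<^sup>2 + 1) + l"
proof -
  have pos: "m > 0" "i > 0" using m by (auto simp: i_def)
  have lam: "0 \<le> lam"
  proof -
    have "a * a \<le> a * (1/4)" using a by (intro mult_left_mono) auto
    then show ?thesis using a unfolding lam_def power2_eq_square by linarith
  qed
  have s4: "s ^ 4 = i\<^sup>2 * y\<^sup>2"
    using arg_cong[OF y, of "\<lambda>x. x\<^sup>2"] by (simp add: power_mult_distrib flip: power_mult)
  have q1: "i * (a / m * (i * y)) = a * y * i + a * y + a * y / m"
    using pos by (simp add: i_def field_simps)
  have q2: "i * (b / m\<^sup>2 * (i\<^sup>2 * y\<^sup>2)) \<ge> b * y\<^sup>2 * i + 2 * b * y\<^sup>2"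
  proof -
    have "(i + 2) * m\<^sup>2 \<le> i * i\<^sup>2"
      using pos by (simp add: i_def power2_eq_square algebra_simps)
    then have "i + 2 \<le> i * i\<^sup>2 / m\<^sup>2"
      using pos by (simp add: pos_le_divide_eq)
    then have "b * y\<^sup>2 * (i + 2) \<le> b * y\<^sup>2 * (i * i\<^sup>2 / m\<^sup>2)"
      using b by (intro mult_left_mono) auto
    then show ?thesis by (simp add: algebra_simps)
  qed
  have q3: "i * ((a / i + lam / i\<^sup>2) * (i * y + 1)) = a * y * i + a + lam * y + lam / i"
    using pos by (simp add: power2_eq_square distrib_left distrib_right)
  have q4: "i * (b / i\<^sup>2 * (i\<^sup>2 * y\<^sup>2 + 6 * (i * y) + 1)) = b * y\<^sup>2 * i + 6 * b * y + b / i"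
    using pos by (simp add: power2_eq_square distrib_left distrib_right)
  have q5: "i * ((a - d) / i) = a - d" using pos by simp
  have q6: "0 \<le> lam / i" using lam pos by simp
  have q7: "lam * y = a * y - 2 * a\<^sup>2 * y" by (simp add: lam_def algebra_simps)
  have q8: "y * (2 * a\<^sup>2 + 6 * b + a / m) = 2 * a\<^sup>2 * y + 6 * b * y + a * y / m"
    by (simp add: algebra_simps)
  have "i * ((a - d) / i + (a / m * (i * y) - b / m\<^sup>2 * (i\<^sup>2 * y\<^sup>2)))
     \<le> i * ((a / i + lam / i\<^sup>2) * (i * y + 1) - b / i\<^sup>2 * (i\<^sup>2 * y\<^sup>2 + 6 * (i * y) + 1) + l)"
    unfolding distrib_left[of i] right_diff_distrib[of i] q1 q3 q4 q5
    using q2 q6 q7 l unfolding q8 by linarith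
  then show ?thesis unfolding y s4 using pos by simp
qed

text \<open>On \<open>y \<le> R\<close> the square of \<open>D\<close> is of order 1/i. Its
  quadratic term cancels \<open>2 * a\<^sup>2 * y\<close> and leaves
  \<open>(2 - 8 * a) * b * y\<^sup>2\<close>, positive for \<open>a < 1/4\<close>. Completing the
  square against \<open>6 * b * y\<close> costs \<open>9 * b / (2 - 8 * a)\<close>; one more
  \<open>b / (2 - 8 * a)\<close>, at least \<open>b / 2\<close>, pays for all errors of order 1/m
  once \<open>m\<close> is beyond the threshold.\<close>

lemma step_drift_lower:
  fixes a b m y R D :: real
  assumes a: "0 \<le> a" "a < 1/4" and b: "0 < b" "b \<le> 1"
    and y: "0 \<le> y" "y \<le> R" and R: "R = 4 / b"
  defines "lam \<equiv> a - 2 * a\<^sup>2" and "i \<equiv> m + 1"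
  assumes m: "2 * (1 + 67 * R + (421 * R)\<^sup>2) / b \<le> m" "1 \<le> m"
  assumes D: "i * D\<^sup>2 = y * (2 * a - 4 * b * y + (2 * lam - 4 * b) / i)\<^sup>2"
  shows "0 \<le> 10 * b / (2 - 8 * a) - b / i - y * (2 * a\<^sup>2 + 6 * b + a / m) + 2 * b * y\<^sup>2
     + i * (D\<^sup>2 / 2 - D ^ 4 / 4)"
proof -
  define \<eta> where "\<eta> = (2 * lam - 4 * b) / i"
  define g where "g = 2 * a - 4 * b * y"
  have pos: "m > 0" "i > 0" "R > 0" using m b R by (auto simp: i_def)
  have lam: "0 \<le> lam" "lam \<le> 1/4"
  proof -
    have "a * a \<le> a * (1/4)" using a by (intro mult_left_mono) auto
    then show "0 \<le> lam" "lam \<le> 1/4"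
      using a zero_le_square[of a] unfolding lam_def power2_eq_square by linarith+
  qed
  have "\<bar>2 * lam - 4 * b\<bar> \<le> 4" using lam b by linarith
  then have eta: "\<bar>\<eta>\<bar> \<le> 4 / i" using pos by (simp add: \<eta>_def divide_right_mono)
  have eta4: "4 / i \<le> 4" using pos m(2) by (simp add: i_def pos_divide_le_eq)
  have "b * y \<le> b * R" using b y by (intro mult_left_mono) auto
  then have "b * y \<le> 4" using R b by simp
  moreover have "0 \<le> b * y" using b y by simp
  \<comment> \<open>The bound is 1/2 from \<open>2 * a\<close> plus 16 from
    \<open>4 * b * y\<close>. Adding at most 4 for the correction gives 41/2, whose square is
    rounded up to 421.\<close>
  ultimately have g: "\<bar>g\<bar> \<le> 33/2"
    using a unfolding g_def mult.assoc[of 4 b y] by linarith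
  have "\<bar>g + \<eta>\<bar> \<le> 41/2" using g eta eta4 by linarith
  then have "(g + \<eta>)\<^sup>2 \<le> (41/2)\<^sup>2" by (simp only: abs_le_square_iff[symmetric])
  then have "(g + \<eta>)\<^sup>2 \<le> 421" by (simp add: power2_eq_square)
  then have "y * (g + \<eta>)\<^sup>2 \<le> R * 421" using y by (intro mult_mono) auto
  then have iD: "i * D\<^sup>2 \<le> 421 * R" unfolding D g_def \<eta>_def by simp
  have quart: "i * D ^ 4 \<le> (421 * R)\<^sup>2 / i"
  proof -
    have "(i * D\<^sup>2)\<^sup>2 \<le> (421 * R)\<^sup>2" using iD pos by (intro power_mono) auto
    moreover have "(i * D\<^sup>2)\<^sup>2 = i * D ^ 4 * i"
      by (simp add: power_mult_distrib power2_eq_square power4_eq_xxxx)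
    ultimately show ?thesis using pos by (simp add: pos_le_divide_eq)
  qed
  have quad: "2 * a\<^sup>2 * y - 8 * a * b * y\<^sup>2 - 66 * R / i \<le> i * D\<^sup>2 / 2"
  proof -
    have "\<bar>y * (\<eta> * g)\<bar> \<le> R * (4 / i * (33/2))"
      unfolding abs_mult using y eta g pos by (intro mult_mono) auto
    then have "- (66 * R / i) \<le> y * (\<eta> * g)" by (simp add: abs_le_iff)
    moreover have "i * D\<^sup>2 / 2 = 2 * a\<^sup>2 * y - 8 * a * b * y\<^sup>2 + 8 * (b\<^sup>2 * y\<^sup>2 * y) + y * (\<eta> * g) + y * \<eta>\<^sup>2 / 2"
      unfolding D \<eta>_def[symmetric] g_def by (simp add: power2_eq_square field_simps)
    moreover have "0 \<le> 8 * (b\<^sup>2 * y\<^sup>2 * y)" "0 \<le> y * \<eta>\<^sup>2 / 2" using y by auto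
    ultimately show ?thesis by linarith
  qed
  define k where "k = 2 - 8 * a"
  have k: "0 < k" "k \<le> 2" using a by (auto simp: k_def)
  have min: "- (9 * b / k) \<le> k * b * y\<^sup>2 - 6 * b * y"
  proof -
    have "0 \<le> b / k * (k * y - 3)\<^sup>2" using b k by simp
    also have "\<dots> = k * b * y\<^sup>2 - 6 * b * y + 9 * b / k"
      using k by (simp add: power2_diff field_simps power2_eq_square)
    finally show ?thesis by linarith
  qed
  have err: "b / i + y * (a / m) + 66 * R / i + (421 * R)\<^sup>2 / i \<le> b / 2"
  proof -
    have mi: "x / i \<le> x / m" if "0 \<le> x" for x
      using that pos by (intro divide_left_mono) (auto simp: i_def)
    have "y * a \<le> R * 1" using y a by (intro mult_mono) auto
    then have "y * (a / m) \<le> R / m" using pos by (simp add: divide_right_mono)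
    moreover have "b / i \<le> 1 / m" using pos b by (intro frac_le) (auto simp: i_def)
    moreover note mi[of "66 * R"] mi[of "(421 * R)\<^sup>2"]
    ultimately have "b / i + y * (a / m) + 66 * R / i + (421 * R)\<^sup>2 / i
      \<le> 1 / m + R / m + 66 * R / m + (421 * R)\<^sup>2 / m" using pos by auto
    also have "\<dots> = (1 + 67 * R + (421 * R)\<^sup>2) / m" by (simp add: add_divide_distrib)
    also have "\<dots> \<le> b / 2"
    proof -
      have "2 * (1 + 67 * R + (421 * R)\<^sup>2) \<le> m * b"
        using m(1) b by (simp add: pos_divide_le_eq)
      then show ?thesis using pos by (simp add: pos_divide_le_eq algebra_simps)
    qed
    finally show ?thesis .
  qed
  \<comment> \<open>The final combination is linear once all products are treated as atoms, so it is
    stated for arbitrary reals and then instantiated.\<close>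
  have lin: "0 \<le> t10 - e1 - yy + q0 + ii"
    if "h \<le> bk" "t10 = t9 + bk" "kq = q0 - q1" "ii = d2 - d4 / 4" "yy = p0 + p1 + e2" "0 \<le> e4"
      "e1 + e2 + e3 + e4 \<le> h" "- t9 \<le> kq - p1" "p0 - q1 - e3 \<le> d2" "d4 \<le> e4"
    for t10 t9 e1 e2 e3 e4 yy q0 q1 ii h bk kq d2 d4 p0 p1 :: real
    using that by linarith
  show ?thesis unfolding k_def[symmetric]
  proof (rule lin[OF _ _ _ _ _ _ err min quad quart])
    show "b / 2 \<le> b / k" using b k by (intro divide_left_mono) auto
    show "10 * b / k = 9 * b / k + b / k" by (simp add: add_divide_distrib[symmetric])
    show "k * b * y\<^sup>2 = 2 * b * y\<^sup>2 - 8 * a * b * y\<^sup>2" by (simp add: k_def algebra_simps)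
    show "i * (D\<^sup>2 / 2 - D ^ 4 / 4) = i * D\<^sup>2 / 2 - i * D ^ 4 / 4" by (simp add: algebra_simps)
    show "y * (2 * a\<^sup>2 + 6 * b + a / m) = 2 * a\<^sup>2 * y + 6 * b * y + y * (a / m)"
      by (simp add: algebra_simps)
    show "0 \<le> (421 * R)\<^sup>2 / i" using pos by simp
  qed
qed

text \<open>By \<open>step_exponent_lower\<close> it suffices to find a suitable lower bound
  \<open>l\<close> of \<open>ln (cosh D)\<close>. The quartic term costs
  \<open>10 * b / (2 - 8 * a)\<close> of the eigenvalue \<open>a\<close>, which vanishes with
  \<open>b\<close>.\<close>

lemma step_mean_lower:
  fixes a b :: real
  assumes a: "0 \<le> a" "a < 1/4" and b: "0 < b" "b \<le> 1"
  defines "R \<equiv> 4 / b"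
  assumes m: "2 * (1 + 67 * R + (421 * R)\<^sup>2) / b \<le> real m" "1 \<le> m"
  shows "exp ((a - 10 * b / (2 - 8 * a)) / real (Suc m) + (a / real m * s\<^sup>2 - b / (real m)\<^sup>2 * s ^ 4))
     \<le> step_mean (a - 2 * a\<^sup>2) (Suc m) (\<lambda>s. a / real (Suc m) * s\<^sup>2 - b / (real (Suc m))\<^sup>2 * s ^ 4) s"
proof -
  define i where "i = real m + 1"
  define lam where "lam = a - 2 * a\<^sup>2"
  define y where "y = s\<^sup>2 / i"
  define p where "p = a / i + lam / i\<^sup>2"
  define D where "D = 2 * p * s - b / i\<^sup>2 * (4 * s ^ 3 + 4 * s)"
  have i: "i > 0" and Suc_i: "real (Suc m) = i" by (auto simp: i_def)
  have m1: "1 \<le> real m" using m by simp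
  have y: "s\<^sup>2 = i * y" "0 \<le> y" using i by (auto simp: y_def)
  have eq: "step_mean lam (Suc m) (\<lambda>s. a / i * s\<^sup>2 - b / i\<^sup>2 * s ^ 4) s =
     exp (p * (s\<^sup>2 + 1) - b / i\<^sup>2 * (s ^ 4 + 6 * s\<^sup>2 + 1)) * cosh D"
    unfolding step_mean_quartic Let_def p_def D_def Suc_i ..
  \<comment> \<open>For large \<open>y\<close> the quartic term alone wins, so \<open>cosh \<ge> 1\<close> suffices; for bounded \<open>y\<close> the
    argument \<open>D\<close> is of order \<open>1 / \<surd>i\<close> and the fourth order error of \<open>cosh\<close> is negligible.\<close>
  obtain l where l: "exp l \<le> cosh D"
    "0 \<le> 10 * b / (2 - 8 * a) - b / i - y * (2 * a\<^sup>2 + 6 * b + a / real m) + 2 * b * y\<^sup>2 + i * l"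
  proof (cases "y \<le> R")
    case True
    have "D = s / i * (2 * a - 4 * b * y + (2 * lam - 4 * b) / i)"
      using i unfolding D_def p_def y_def
      by (simp add: power2_eq_square power3_eq_cube algebra_simps diff_divide_distrib add_divide_distrib)
    then have "i * D\<^sup>2 = i * (s / i)\<^sup>2 * (2 * a - 4 * b * y + (2 * lam - 4 * b) / i)\<^sup>2"
      by (simp only: power_mult_distrib mult.assoc)
    also have "i * (s / i)\<^sup>2 = y"
      using i by (simp add: y_def power2_eq_square)
    finally have "i * D\<^sup>2 = y * (2 * a - 4 * b * y + (2 * lam - 4 * b) / i)\<^sup>2" .
    from step_drift_lower[OF a b y(2) True R_def[THEN meta_eq_to_obj_eq] m(1) m1 this[unfolded lam_def i_def]]
    show ?thesis using cosh_ge_exp[of D] by (intro that) (auto simp: i_def)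
  next
    case False
    \<comment> \<open>This is where \<open>R = 4 / b\<close> matters: the coefficient of
      \<open>y\<close> is at most 1/8 + 6 + 1/4, below 8, while \<open>2 * (b * y)\<close> is at
      least 8.\<close>
    have by4: "4 \<le> b * y" using False b by (simp add: R_def pos_divide_less_eq mult.commute not_le)
    have "a * a \<le> 1/4 * (1/4)" using a by (intro mult_mono) auto
    moreover have "a / real m \<le> a / 1" using a m1 by (intro divide_left_mono) auto
    ultimately have "2 * a\<^sup>2 + 6 * b + a / real m \<le> 2 * (b * y)"
      using by4 b a unfolding power2_eq_square by linarith
    then have "y * (2 * a\<^sup>2 + 6 * b + a / real m) \<le> y * (2 * (b * y))"
      using y by (intro mult_left_mono)
    moreover have "b / i \<le> 10 * b / (2 - 8 * a)"
      using a b m1 by (intro frac_le) (auto simp: i_def)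
    ultimately show ?thesis using cosh_real_ge_1[of D]
      by (intro that[of 0]) (auto simp: power2_eq_square algebra_simps)
  qed
  have "exp ((a - 10 * b / (2 - 8 * a)) / i + (a / real m * s\<^sup>2 - b / (real m)\<^sup>2 * s ^ 4))
     \<le> exp (p * (s\<^sup>2 + 1) - b / i\<^sup>2 * (s ^ 4 + 6 * s\<^sup>2 + 1) + l)"
    using step_exponent_lower[OF a b(1) m1, folded i_def lam_def, OF y(1) l(2)]
    unfolding p_def by simp
  also have "\<dots> \<le> exp (p * (s\<^sup>2 + 1) - b / i\<^sup>2 * (s ^ 4 + 6 * s\<^sup>2 + 1)) * cosh D"
    unfolding exp_add using l(1) by (intro mult_left_mono) auto
  finally show ?thesis unfolding eq[symmetric] lam_def Suc_i .
qed

lemma mgf_lower: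
  fixes a \<delta> :: real
  assumes a: "0 < a" "a < 1/4" and \<delta>: "0 < \<delta>" "\<delta> \<le> a"
  shows "\<exists>C>0. \<forall>\<^sub>F n in sequentially. C * real n powr (a - \<delta>) \<le> tilt (a - 2 * a\<^sup>2) n (\<lambda>_. 0)"
proof -
  define b where "b = min 1 (\<delta> * (2 - 8 * a) / 10)"
  define R where "R = 4 / b"
  define lam where "lam = a - 2 * a\<^sup>2"
  define f where "f i s = a / real i * s\<^sup>2 - b / (real i)\<^sup>2 * s ^ 4" for i and s :: real
  have b: "0 < b" "b \<le> 1" "b \<le> \<delta> * (2 - 8 * a) / 10"
    using a \<delta> by (auto simp: b_def)
  then have bd: "10 * b / (2 - 8 * a) \<le> \<delta>"
    using a by (simp add: pos_divide_le_eq)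
  obtain N0 where N0: "2 * (1 + 67 * R + (421 * R)\<^sup>2) / b \<le> real N0"
    using real_arch_simple by blast
  define N where "N = max 1 N0"
  have N: "2 * (1 + 67 * R + (421 * R)\<^sup>2) / b \<le> real N" "1 \<le> N"
    using N0 by (auto simp: N_def)
  \<comment> \<open>Makes the base case an equality. The base \<open>n + 1\<close> instead of
    \<open>n\<close> fits the step from \<open>m\<close>: the ratio (m + 2)/(m + 1) is at most
    \<open>exp (1 / (m + 1))\<close>.\<close>
  define K where "K = tilt lam N (f N) / (real N + 1) powr (a - \<delta>)"
  have K: "K > 0" by (simp add: K_def tilt_pos)
  have main: "K * (real n + 1) powr (a - \<delta>) \<le> tilt lam n (f n)" if "N \<le> n" for n
    using that
  proof (induction n rule: nat_induct_at_least)
    case base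
    show ?case by (simp add: K_def)
  next
    case (Suc m)
    have "K * (real (Suc m) + 1) powr (a - \<delta>)
      = ((real m + 2) / (real m + 1)) powr (a - \<delta>) * (K * (real m + 1) powr (a - \<delta>))"
      by (simp add: powr_divide add.commute)
    also have "\<dots> \<le> exp ((a - 10 * b / (2 - 8 * a)) / real (Suc m)) * tilt lam m (f m)"
    proof (intro mult_mono)
      have "(real m + 2) / (real m + 1) = 1 + 1 / real (Suc m)" by (simp add: field_simps)
      also have "\<dots> \<le> exp (1 / real (Suc m))" by (rule exp_ge_add_one_self)
      finally have "((real m + 2) / (real m + 1)) powr (a - \<delta>) \<le> exp (1 / real (Suc m)) powr (a - \<delta>)"
        using \<delta> by (intro powr_mono2) auto
      also have "\<dots> = exp ((a - \<delta>) / real (Suc m))" by (simp add: powr_def)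
      also have "\<dots> \<le> exp ((a - 10 * b / (2 - 8 * a)) / real (Suc m))"
        using bd by (simp add: divide_right_mono)
      finally show "((real m + 2) / (real m + 1)) powr (a - \<delta>) \<le> \<dots>" .
    qed (use Suc K in auto)
    also have "\<dots> \<le> tilt lam (Suc m) (f (Suc m))"
      unfolding lam_def f_def
      using Suc N a b by (intro tilt_Suc_ge step_mean_lower) (auto simp: R_def)
    finally show ?case .
  qed
  define C where "C = K / exp (a\<^sup>2 / (4 * b))"
  have "C * real n powr (a - \<delta>) \<le> tilt lam n (\<lambda>_. 0)" if "N \<le> n" for n
  proof -
    have "K * real n powr (a - \<delta>) \<le> K * (real n + 1) powr (a - \<delta>)"
      using K \<delta> by (intro mult_left_mono powr_mono2) auto
    also note main[OF that]
    \<comment> \<open>Completing the square: the quartic term bounds the terminal weight, so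
      removing it costs only a constant factor.\<close>
    also have "tilt lam n (f n) \<le> tilt lam n (\<lambda>_. a\<^sup>2 / (4 * b) + 0)"
    proof (rule tilt_mono)
      fix s :: real
      define z where "z = s\<^sup>2 / real n"
      have "0 \<le> b * (z - a / (2 * b))\<^sup>2" using b by simp
      also have "\<dots> = a\<^sup>2 / (4 * b) - (a * z - b * z\<^sup>2)"
        using b by (simp add: power2_diff field_simps power2_eq_square)
      also have "a * z - b * z\<^sup>2 = f n s"
        by (simp add: f_def z_def power_divide flip: power_mult)
      finally show "f n s \<le> a\<^sup>2 / (4 * b) + 0" by simp
    qed
    also have "\<dots> = exp (a\<^sup>2 / (4 * b)) * tilt lam n (\<lambda>_. 0)" by (rule tilt_add_const)
    finally show ?thesis unfolding C_def by (simp add: field_simps)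
  qed
  moreover have "C > 0" using K by (simp add: C_def)
  ultimately show ?thesis unfolding lam_def eventually_sequentially by blast
qed

subsection \<open>Tail probabilities\<close>

lemma tailprob_eq_sum:
  "tailprob c n = (\<Sum>xi\<in>sign_seqs n. indicator {xi. c * ln (real n) \<le> Lsum xi n} xi) / 2 ^ n"
  unfolding tailprob_def
  by (simp add: measure_pmf_of_set card_sign_seqs indicator_def sum.If_cases)

text \<open>Exponential Markov inequality combined with \<open>mgf_upper\<close>.\<close>

lemma tailprob_upper:
  fixes a c :: real
  assumes a: "0 \<le> a" "a < 1/4" and n: "1 \<le> n"
  shows "tailprob c n \<le> exp 2 * real n powr (a - (a - 2 * a\<^sup>2) * c)"
proof -
  define lam where "lam = a - 2 * a\<^sup>2"
  have "a * a \<le> a * (1/4)" using a by (intro mult_left_mono) auto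
  then have lam: "0 \<le> lam" using a unfolding lam_def power2_eq_square by linarith
  have pt: "indicator {xi. c * ln (real n) \<le> Lsum xi n} xi \<le> real n powr (- (lam * c)) * exp (lam * Lsum xi n)" for xi
  proof (cases "c * ln (real n) \<le> Lsum xi n")
    case True
    have "0 \<le> - (lam * c) * ln (real n) + lam * Lsum xi n"
      using mult_left_mono[OF True lam] by (simp add: mult.assoc)
    then show ?thesis using n True by (simp add: powr_def exp_add[symmetric])
  qed (simp add: indicator_def)
  have "tailprob c n \<le> (\<Sum>xi\<in>sign_seqs n. real n powr (- (lam * c)) * exp (lam * Lsum xi n)) / 2 ^ n"
    unfolding tailprob_eq_sum by (intro divide_right_mono sum_mono pt) auto
  also have "\<dots> = real n powr (- (lam * c)) * tilt lam n (\<lambda>_. 0)"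
    by (simp add: tilt_def sum_distrib_left)
  also have "\<dots> \<le> real n powr (- (lam * c)) * (exp 2 * real n powr a)"
    using mgf_upper[OF a n] by (intro mult_left_mono) (auto simp: lam_def)
  also have "\<dots> = exp 2 * real n powr (a - lam * c)"
    by (simp add: powr_add[symmetric])
  finally show ?thesis unfolding lam_def .
qed

text \<open>Splits at \<open>c * ln n\<close> and \<open>d * ln n\<close>. Below the first the
  parameter is lowered to \<open>l0\<close>, above the second it is raised to \<open>l2\<close>; in
  between the weight is at most \<open>n powr (l1 * d)\<close> and the tail event occurs.\<close>

lemma tilt_le_tailprob:
  fixes l0 l1 l2 c d :: real
  assumes l: "0 \<le> l1" "l0 \<le> l1" "l1 \<le> l2" and n: "1 \<le> n"
  shows "tilt l1 n (\<lambda>_. 0) \<le> real n powr (l1 * d) * tailprob c n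
     + (real n powr (- ((l2 - l1) * d)) * tilt l2 n (\<lambda>_. 0)
     + real n powr ((l1 - l0) * c) * tilt l0 n (\<lambda>_. 0))"
proof -
  have pt: "exp (l1 * Lsum xi n) \<le> real n powr (l1 * d) * indicator {xi. c * ln (real n) \<le> Lsum xi n} xi
     + (real n powr (- ((l2 - l1) * d)) * exp (l2 * Lsum xi n)
     + real n powr ((l1 - l0) * c) * exp (l0 * Lsum xi n))" (is "?L \<le> ?A + (?B + ?C)") for xi
  proof -
    have nn: "0 \<le> ?A" "0 \<le> ?B" "0 \<le> ?C" by auto
    consider "Lsum xi n < c * ln (real n)" | "d * ln (real n) < Lsum xi n"
      | "c * ln (real n) \<le> Lsum xi n" "Lsum xi n \<le> d * ln (real n)" by linarith
    then show ?thesis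
    proof cases
      case 1
      have "(l1 - l0) * Lsum xi n \<le> (l1 - l0) * (c * ln (real n))"
        using 1 l by (intro mult_left_mono) auto
      then have "?L \<le> ?C" using n by (simp add: powr_def exp_add[symmetric] algebra_simps)
      then show ?thesis using nn by linarith
    next
      case 2
      have "(l2 - l1) * (d * ln (real n)) \<le> (l2 - l1) * Lsum xi n"
        using 2 l by (intro mult_left_mono) auto
      then have "?L \<le> ?B" using n by (simp add: powr_def exp_add[symmetric] algebra_simps)
      then show ?thesis using nn by linarith
    next
      case 3
      have "l1 * Lsum xi n \<le> l1 * (d * ln (real n))"
        using 3 l by (intro mult_left_mono) auto
      then have "?L \<le> ?A" using n 3 by (simp add: powr_def algebra_simps)
      then show ?thesis using nn by linarith
    qed
  qed
  have "tilt l1 n (\<lambda>_. 0) \<le> (\<Sum>xi\<in>sign_seqs n.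
      real n powr (l1 * d) * indicator {xi. c * ln (real n) \<le> Lsum xi n} xi
     + (real n powr (- ((l2 - l1) * d)) * exp (l2 * Lsum xi n)
     + real n powr ((l1 - l0) * c) * exp (l0 * Lsum xi n))) / 2 ^ n"
    unfolding tilt_def add_0_right by (intro divide_right_mono sum_mono pt) auto
  then show ?thesis
    by (simp add: tilt_def tailprob_eq_sum sum.distrib sum_distrib_left[symmetric] add_divide_distrib)
qed

text \<open>The derivative of \<open>lam\<close> at \<open>a\<close> is \<open>1 - 4 * a\<close>,
  with \<open>(1 - 4 * a) * c < 1 < (1 - 4 * a) * d\<close>. Hence for parameters
  \<open>a - t\<close> and \<open>a + t\<close> with small \<open>t\<close>, both outer terms of
  \<open>tilt_le_tailprob\<close> have exponents below \<open>a\<close>, and the middle term must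
  carry the mass.\<close>

lemma tailprob_lower:
  fixes a c d \<delta> :: real
  assumes a: "0 < a" "a < 1/4" and c: "1 \<le> c" "c < 1 / (1 - 4 * a)" and d: "1 / (1 - 4 * a) < d"
    and \<delta>: "0 < \<delta>"
  shows "\<forall>\<^sub>F n in sequentially. real n powr (a - (a - 2 * a\<^sup>2) * d - \<delta>) \<le> tailprob c n"
proof -
  define lam :: "real \<Rightarrow> real" where "lam x = x - 2 * x\<^sup>2" for x
  have d0: "0 < d" using d a by (intro less_trans[OF _ d]) simp
  have cc: "(1 - 4 * a) * c < 1" using c a by (simp add: pos_less_divide_eq mult.commute)
  have dd: "1 < (1 - 4 * a) * d" using d a by (simp add: pos_divide_less_eq mult.commute)
  \<comment> \<open>The first two bounds keep \<open>a - t\<close> and \<open>a + t\<close> inside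
    (0, 1/4); the last two keep the second-order terms within half of the slack in the derivative
    inequalities.\<close>
  define t where "t = min (min (a / 2) ((1/4 - a) / 2))
     (min (((1 - 4 * a) * d - 1) / (4 * d)) ((1 - (1 - 4 * a) * c) / (4 * c)))"
  have t1: "0 < t"
    using a c d0 cc dd by (simp add: t_def)
  have t: "0 < t" "t \<le> a / 2" "t \<le> (1/4 - a) / 2"
    "t \<le> ((1 - 4 * a) * d - 1) / (4 * d)" "t \<le> (1 - (1 - 4 * a) * c) / (4 * c)"
    using t1 by (simp_all only: t_def min_le_iff_disj order.refl simp_thms)
  have t2: "4 * (d * t) \<le> (1 - 4 * a) * d - 1"
    using t(4) d0 by (simp add: pos_le_divide_eq algebra_simps)
  have t3: "4 * (c * t) \<le> 1 - (1 - 4 * a) * c"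
    using t(5) c by (simp add: pos_le_divide_eq algebra_simps)
  have dt: "0 < d * t" and ct: "0 < c * t" using d0 c t by auto
  define e1 where "e1 = (a + t) - (lam (a + t) - lam a) * d"
  define e2 where "e2 = (a - t) + (lam a - lam (a - t)) * c"
  have "e1 = a + t * (1 - ((1 - 4 * a) * d - 2 * (d * t)))"
    by (simp add: e1_def lam_def power2_eq_square algebra_simps)
  moreover have "t * (1 - ((1 - 4 * a) * d - 2 * (d * t))) < 0"
    using t(1) t2 dt by (intro mult_pos_neg) auto
  ultimately have e1: "e1 < a" by linarith
  have "e2 = a + t * ((1 - 4 * a) * c + 2 * (c * t) - 1)"
    by (simp add: e2_def lam_def power2_eq_square algebra_simps)
  moreover have "t * ((1 - 4 * a) * c + 2 * (c * t) - 1) < 0"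
    using t(1) t3 ct by (intro mult_pos_neg) auto
  ultimately have e2: "e2 < a" by linarith
  define \<delta>' where "\<delta>' = min (min a \<delta>) (min (a - e1) (a - e2)) / 2"
  have \<delta>': "0 < \<delta>'" "\<delta>' \<le> a" "\<delta>' < \<delta>" "e1 < a - \<delta>'" "e2 < a - \<delta>'"
    using a \<delta> e1 e2 by (auto simp: \<delta>'_def min_def field_simps)
  define x where "x = a - \<delta>'"
  obtain C where C: "C > 0" "\<forall>\<^sub>F n in sequentially. C * real n powr x \<le> tilt (lam a) n (\<lambda>_. 0)"
    using mgf_lower[OF a \<delta>'(1,2)] unfolding lam_def x_def by blast
  \<comment> \<open>The third summand reserves \<open>n powr (a - \<delta>)\<close>, so that this
    much remains after both outer terms are subtracted.\<close>
  have "((\<lambda>n. exp 2 * real n powr (e1 - x) + exp 2 * real n powr (e2 - x) + real n powr (a - \<delta> - x))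
      \<longlongrightarrow> exp 2 * 0 + exp 2 * 0 + 0) sequentially"
    using \<delta>' unfolding x_def
    by (intro tendsto_intros tendsto_neg_powr filterlim_real_sequentially) auto
  then have "\<forall>\<^sub>F n in sequentially.
      exp 2 * real n powr (e1 - x) + exp 2 * real n powr (e2 - x) + real n powr (a - \<delta> - x) < C"
    using C(1) by (intro order_tendstoD) auto
  then show ?thesis
    using C(2) eventually_ge_at_top[of 1]
  proof eventually_elim
    case (elim n)
    have n: "real n > 0" using elim by simp
    have "(exp 2 * real n powr (e1 - x) + exp 2 * real n powr (e2 - x) + real n powr (a - \<delta> - x)) * real n powr x
        \<le> C * real n powr x"
      using elim by (intro mult_right_mono) auto
    then have 1: "exp 2 * real n powr e1 + exp 2 * real n powr e2 + real n powr (a - \<delta>) \<le> C * real n powr x"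
      by (simp add: distrib_right mult.assoc powr_add[symmetric])
    have "lam a = a * (1 - 2 * a)" "lam a - lam (a - t) = t * (1 - 4 * a + 2 * t)"
      "lam (a + t) - lam a = t * (1 - 4 * a - 2 * t)"
      by (auto simp: lam_def power2_eq_square algebra_simps)
    moreover have "0 \<le> a * (1 - 2 * a)" "0 \<le> t * (1 - 4 * a + 2 * t)" "0 \<le> t * (1 - 4 * a - 2 * t)"
      using a t by auto
    ultimately have lams: "0 \<le> lam a" "lam (a - t) \<le> lam a" "lam a \<le> lam (a + t)"
      by linarith+
    have "real n powr (- ((lam (a + t) - lam a) * d)) * tilt (lam (a + t)) n (\<lambda>_. 0)
       \<le> real n powr (- ((lam (a + t) - lam a) * d)) * (exp 2 * real n powr (a + t))"
      unfolding lam_def using a t elim by (intro mult_left_mono mgf_upper) auto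
    also have "\<dots> = exp 2 * real n powr e1"
      by (simp add: e1_def powr_add[symmetric])
    finally have 2: "real n powr (- ((lam (a + t) - lam a) * d)) * tilt (lam (a + t)) n (\<lambda>_. 0) \<le> exp 2 * real n powr e1" .
    have "real n powr ((lam a - lam (a - t)) * c) * tilt (lam (a - t)) n (\<lambda>_. 0)
       \<le> real n powr ((lam a - lam (a - t)) * c) * (exp 2 * real n powr (a - t))"
      unfolding lam_def using a t elim by (intro mult_left_mono mgf_upper) auto
    also have "\<dots> = exp 2 * real n powr e2"
      by (simp add: e2_def powr_add[symmetric] add.commute)
    finally have 3: "real n powr ((lam a - lam (a - t)) * c) * tilt (lam (a - t)) n (\<lambda>_. 0) \<le> exp 2 * real n powr e2" .
    have "real n powr (a - \<delta>) \<le> real n powr (lam a * d) * tailprob c n"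
      using tilt_le_tailprob[OF lams, of n d c] elim 1 2 3 by linarith
    moreover have "real n powr (a - lam a * d - \<delta>) = real n powr (a - \<delta>) / real n powr (lam a * d)"
      by (simp add: powr_diff[symmetric] algebra_simps)
    ultimately have "real n powr (a - lam a * d - \<delta>) \<le> tailprob c n"
      using n by (simp add: pos_divide_le_eq mult.commute)
    then show ?case unfolding lam_def .
  qed
qed

section \<open>Optimising the parameter and the rate function\<close>

text \<open>At \<open>t = 0\<close> the tilted mean \<open>1 / (1 - 4 * a t)\<close> equals
  \<open>c\<close> and the exponent is \<open>- Krate c\<close>. A small \<open>t > 0\<close> gives
  the strict inequalities, also for \<open>c = 1\<close>, and changes the exponent little by
  continuity.\<close>

lemma tailprob_lower_Krate:
  fixes c \<eta> :: real
  assumes c: "1 \<le> c" and \<eta>: "0 < \<eta>"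
  shows "\<forall>\<^sub>F n in sequentially. real n powr (- Krate c - \<eta>) \<le> tailprob c n"
proof -
  define a where "a t = 1/4 - 1 / (4 * c) + t" for t :: real
  define h where "h t = a t - (a t - 2 * (a t)\<^sup>2) * (1 / (1 - 4 * a t) + t)" for t
  have h0: "h 0 = - Krate c"
    using c unfolding h_def a_def Krate_def by (simp add: field_simps power2_eq_square)
  have "(h \<longlongrightarrow> h 0) (at_right 0)"
    unfolding h_def a_def using c by (intro tendsto_intros) (auto simp: field_simps)
  then have "\<forall>\<^sub>F t in at_right 0. - Krate c - \<eta> / 2 < h t"
    using \<eta> by (intro order_tendstoD) (auto simp: h0)
  moreover have "\<forall>\<^sub>F t in at_right 0. t \<in> {0<..<1 / (4 * c)}"
    using c by (intro eventually_at_right_real) auto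
  ultimately have "\<forall>\<^sub>F t in at_right 0. - Krate c - \<eta> / 2 < h t \<and> t \<in> {0<..<1 / (4 * c)}"
    by (rule eventually_conj)
  then obtain t where t: "- Krate c - \<eta> / 2 < h t" "0 < t" "t < 1 / (4 * c)"
    using eventually_happens[of _ "at_right (0::real)"] by (auto simp: trivial_limit_at_right_real)
  have "1 / (4 * c) \<le> 1/4" using c by (simp add: field_simps)
  then have a: "0 < a t" "a t < 1/4" using t by (auto simp: a_def)
  have a4: "1 - 4 * a t = 1 / c - 4 * t" by (simp add: a_def)
  have "(1 - 4 * a t) * c < 1" using t c unfolding a4 by (simp add: algebra_simps)
  then have ca: "c < 1 / (1 - 4 * a t)" using a by (simp add: pos_less_divide_eq mult.commute)
  have "\<forall>\<^sub>F n in sequentially. real n powr (a t - (a t - 2 * (a t)\<^sup>2) * (1 / (1 - 4 * a t) + t) - \<eta> / 2) \<le> tailprob c n"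
    using a c ca t \<eta> by (intro tailprob_lower) auto
  then show ?thesis
    using eventually_ge_at_top[of 1]
  proof eventually_elim
    case (elim n)
    have "real n powr (- Krate c - \<eta>) \<le> real n powr (h t - \<eta> / 2)"
      using elim t by (intro powr_mono) auto
    then show ?case using elim unfolding h_def by linarith
  qed
qed

lemma tailprob_upper_Krate:
  assumes c: "1 \<le> c" and n: "1 \<le> n"
  shows "tailprob c n \<le> exp 2 * real n powr (- Krate c)"
proof -
  \<comment> \<open>The minimiser of \<open>a - (a - 2 * a\<^sup>2) * c\<close> over
    \<open>a\<close>.\<close>
  define a where "a = 1/4 - 1 / (4 * c)"
  have a: "0 \<le> a" "a < 1/4"
    using c by (auto simp: a_def field_simps)
  have "a - (a - 2 * a\<^sup>2) * c = - Krate c"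
    using c unfolding a_def Krate_def by (simp add: field_simps power2_eq_square)
  then show ?thesis
    using tailprob_upper[OF a n, of c] by simp
qed

theorem mainTheorem2:
  fixes c :: real
  assumes "c \<ge> 1"
  shows "\<exists>\<epsilon> :: nat \<Rightarrow> real. \<epsilon> \<longlonglongrightarrow> 0 \<and>
           (\<forall>\<^sub>F n in sequentially. tailprob c n = real n powr (- Krate c + \<epsilon> n))"
proof -
  \<comment> \<open>The required identity solved for its error term; it is used from
    \<open>n = 2\<close> on, where \<open>ln n\<close> is nonzero.\<close>
  define \<epsilon> where "\<epsilon> n = ln (tailprob c n) / ln (real n) + Krate c" for n
  have pos: "\<forall>\<^sub>F n in sequentially. 0 < tailprob c n"
    using tailprob_lower_Krate[OF assms zero_less_one] eventually_ge_at_top[of 1]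
    by eventually_elim (auto intro: less_le_trans[rotated])
  have "\<forall>\<^sub>F n in sequentially. tailprob c n = real n powr (- Krate c + \<epsilon> n)"
    using pos eventually_ge_at_top[of 2]
    by eventually_elim (simp add: \<epsilon>_def powr_def)
  moreover have "\<epsilon> \<longlonglongrightarrow> 0"
  proof (rule order_tendstoI)
    fix \<eta> :: real
    assume "\<eta> < 0"
    then have "\<forall>\<^sub>F n in sequentially. real n powr (- Krate c - (- \<eta> / 2)) \<le> tailprob c n"
      by (intro tailprob_lower_Krate assms) auto
    then show "\<forall>\<^sub>F n in sequentially. \<eta> < \<epsilon> n"
      using pos eventually_ge_at_top[of 2]
    proof eventually_elim
      case (elim n)
      then have "ln (real n powr (- Krate c - (- \<eta> / 2))) \<le> ln (tailprob c n)"
        by (subst ln_le_cancel_iff) auto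
      then have "- Krate c - (- \<eta> / 2) \<le> ln (tailprob c n) / ln (real n)"
        using elim by (simp add: ln_powr pos_le_divide_eq)
      then show ?case using \<open>\<eta> < 0\<close> unfolding \<epsilon>_def by linarith
    qed
  next
    fix \<eta> :: real
    assume "0 < \<eta>"
    \<comment> \<open>The factor \<open>exp 2\<close> in the upper bound shifts the exponent by this
      amount.\<close>
    have "(\<lambda>n. 2 / ln (real n)) \<longlonglongrightarrow> 0"
      by (intro tendsto_divide_0[OF tendsto_const] filterlim_at_top_imp_at_infinity filterlim_compose[OF ln_at_top filterlim_real_sequentially])
    then have "\<forall>\<^sub>F n in sequentially. 2 / ln (real n) < \<eta>"
      using \<open>0 < \<eta>\<close> by (rule order_tendstoD)
    then show "\<forall>\<^sub>F n in sequentially. \<epsilon> n < \<eta>"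
      using pos eventually_ge_at_top[of 2]
    proof eventually_elim
      case (elim n)
      have "ln (tailprob c n) \<le> ln (exp 2 * real n powr (- Krate c))"
        using elim tailprob_upper_Krate[OF assms, of n] by (subst ln_le_cancel_iff) auto
      also have "\<dots> = 2 - Krate c * ln (real n)"
        using elim by (simp add: ln_mult ln_powr)
      finally have "ln (tailprob c n) / ln (real n) \<le> (2 - Krate c * ln (real n)) / ln (real n)"
        using elim by (intro divide_right_mono) auto
      also have "\<dots> = 2 / ln (real n) - Krate c"
        using elim by (simp add: diff_divide_distrib)
      finally show ?case using elim unfolding \<epsilon>_def by linarith
    qed
  qed
  ultimately show ?thesis by blast
qed

end
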